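(* Let $m\in\mathbb N$ and $k>6$. (i) The assignment $\sigma_i\mapsto\psi_m(\sigma_i)$, $1\le i\le k-1$, defines a homomorphism $\psi_m\colon B_k\to S_{mk}$, and this homomorphism is non-cyclic and transitive. (ii) Let $l$ be a divisor of $m$ with $1\le l<m$, and let $t=(t^i_q)$, $1\le i\le k-1$, $(i-1)l+1\le q\le (i+1)l$, be a family of elements of $\bigtriangledown_{m/l}$ such that for all $1\le i\le k-2$ and all $j\in\bigtriangledown_l$ $$t^i_{(i-1)l+1+|1+j|_l}+t^i_{il+1+|1+j|_l}\equiv t^{i+1}_{(i+1)l+1+j}+t^{i+1}_{il+1+|1+j|_l}\pmod{m/l}.$$ Then the assignment $\sigma_i\mapsto\phi_{m,l,t}(\sigma_i)$, $1\le i\le k-1$, defines a homomorphism $\phi_{m,l,t}\colon B_k\to S_{mk}$, and this homomorphism is non-cyclic and transitive.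
   Context: $B_k$ is the braid group with generators $\sigma_1,\dots,\sigma_{k-1}$ and relations $\sigma_i\sigma_j=\sigma_j\sigma_i$ for $|i-j|\ge2$ and $\sigma_i\sigma_{i+1}\sigma_i=\sigma_{i+1}\sigma_i\sigma_{i+1}$. $S_n$ is the symmetric group on $\{1,\dots,n\}$ acting from the left, so $(\sigma\tau)(x)=\sigma(\tau(x))$; permutations of a subset are extended by the identity. A homomorphism to $S_n$ is transitive if its image acts transitively on $\{1,\dots,n\}$, and cyclic if its image is a cyclic group. For $n\ge1$: $\bigtriangledown_n=\{0,\dots,n-1\}$; $|a|_n\in\bigtriangledown_n$ is the residue of $a\in\mathbb Z$ modulo $n$; for $i\ge1$ and $q\in\bigtriangledown_n$ put $a^{(n)}_{i,q}=1+n(i-1)+q$; $A^n_i$ is the $n$-cycle $(1+n(i-1),2+n(i-1),\dots,ni)$ (the identity if $n=1$). For a permutation $\sigma$ of $\{j,\dots,j+r-1\}$ and $t_j,\dots,t_{j+r-1}\in\bigtriangledown_n$, $C^{\sigma,n}_{t_j,\dots,t_{j+r-1}}$ is the permutation of $\{n(j-1)+1,\dots,n(j+r-1)\}$ given by $a^{(n)}_{i,q}\mapsto a^{(n)}_{\sigma(i),\,|q+t_{\sigma(i)}|_n}$ for $j\le i\le j+r-1$, $q\in\bigtriangledown_n$. For $l\ge1$ and $1\le i\le k-1$, $\psi_l(\sigma_i)\in S_{lk}$ is the $2l$-cycle $(a^{(l)}_{i,0},a^{(l)}_{i+1,0},a^{(l)}_{i,1},a^{(l)}_{i+1,1},\dots,a^{(l)}_{i,l-1},a^{(l)}_{i+1,l-1})$;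 it is also regarded as a permutation of $\{l(i-1)+1,\dots,l(i+1)\}$. For $l\mid m$, $1\le l<m$, and a family $t=(t^i_q)$ with $t^i_q\in\bigtriangledown_{m/l}$, put $$\phi_{m,l,t}(\sigma_i)=A^{m/l}_1\cdots A^{m/l}_{(i-1)l}\cdot C^{\psi_l(\sigma_i),m/l}_{t^i_{(i-1)l+1},\dots,t^i_{(i+1)l}}\cdot A^{m/l}_{(i+1)l+1}\cdots A^{m/l}_{kl}\in S_{mk}.$$ *)

theory Defs
  imports
    "HOL-Algebra.Sym_Groups"
    "HOL-Algebra.Elementary_Groups"
    "HOL-Number_Theory.Cong"
begin

section \<open>Groups given by generators and relations\<close>

text \<open>A letter \<open>(s, True)\<close> stands for the generator \<open>s\<close>, and \<open>(s, False)\<close> for its formal inverse.\<close>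

type_synonym 'a gword = "('a \<times> bool) list"

inductive pres_eq :: "'a set \<Rightarrow> ('a gword \<times> 'a gword) set \<Rightarrow> 'a gword \<Rightarrow> 'a gword \<Rightarrow> bool"
  for S R where
  refl: "w \<in> lists (S \<times> UNIV) \<Longrightarrow> pres_eq S R w w"
| sym: "pres_eq S R u v \<Longrightarrow> pres_eq S R v u"
| trans: "pres_eq S R u v \<Longrightarrow> pres_eq S R v w \<Longrightarrow> pres_eq S R u w"
| app: "pres_eq S R u u' \<Longrightarrow> pres_eq S R v v' \<Longrightarrow> pres_eq S R (u @ v) (u' @ v')"
| cancel: "s \<in> S \<Longrightarrow> pres_eq S R [(s, b), (s, \<not> b)] []"
| rel: "(u, v) \<in> R \<Longrightarrow> u \<in> lists (S \<times> UNIV) \<Longrightarrow> v \<in> lists (S \<times> UNIV) \<Longrightarrow> pres_eq S R u v"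

definition pres_rel :: "'a set \<Rightarrow> ('a gword \<times> 'a gword) set \<Rightarrow> ('a gword \<times> 'a gword) set" where
  "pres_rel S R = {(u, v). pres_eq S R u v}"

definition presented_group :: "'a set \<Rightarrow> ('a gword \<times> 'a gword) set \<Rightarrow> 'a gword set monoid" where
  "presented_group S R =
     \<lparr> carrier = lists (S \<times> UNIV) // pres_rel S R,
       mult = (\<lambda>A B. \<Union>u\<in>A. \<Union>v\<in>B. pres_rel S R `` {u @ v}),
       one = pres_rel S R `` {[]} \<rparr>"

lemma pres_eq_words:
  assumes "pres_eq S R u v"
  shows "u \<in> lists (S \<times> UNIV) \<and> v \<in> lists (S \<times> UNIV)"
  using assms by induction auto

lemma equiv_pres_rel: "equiv (lists (S \<times> UNIV)) (pres_rel S R)"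
proof (rule equivI)
  show "pres_rel S R \<subseteq> lists (S \<times> UNIV) \<times> lists (S \<times> UNIV)"
    by (auto simp: pres_rel_def dest: pres_eq_words)
  show "refl_on (lists (S \<times> UNIV)) (pres_rel S R)"
    by (auto simp: refl_on_def pres_rel_def intro: pres_eq.refl)
  show "Relation.sym (pres_rel S R)"
    by (auto simp: sym_def pres_rel_def intro: pres_eq.sym)
  show "Relation.trans (pres_rel S R)"
    by (auto simp: trans_def pres_rel_def intro: pres_eq.trans)
qed

lemma presented_group_mult:
  assumes "u \<in> lists (S \<times> UNIV)" "v \<in> lists (S \<times> UNIV)"
  shows "(pres_rel S R `` {u}) \<otimes>\<^bsub>presented_group S R\<^esub> (pres_rel S R `` {v}) = pres_rel S R `` {u @ v}"
proof -
  have *: "pres_rel S R `` {u' @ v'} = pres_rel S R `` {u @ v}"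
    if "u' \<in> pres_rel S R `` {u}" "v' \<in> pres_rel S R `` {v}" for u' v'
    by (rule equiv_class_eq[OF equiv_pres_rel, symmetric])
       (use that in \<open>auto simp: pres_rel_def intro: pres_eq.app\<close>)
  have "u \<in> pres_rel S R `` {u}" "v \<in> pres_rel S R `` {v}"
    using assms by (auto simp: pres_rel_def intro: pres_eq.refl)
  then have "(\<Union>u'\<in>pres_rel S R `` {u}. \<Union>v'\<in>pres_rel S R `` {v}. pres_rel S R `` {u' @ v'})
      = pres_rel S R `` {u @ v}"
    using * by blast
  then show ?thesis by (simp add: presented_group_def)
qed

lemma pres_eq_inverse:
  assumes "w \<in> lists (S \<times> UNIV)"
  shows "pres_eq S R (rev (map (\<lambda>(s, b). (s, \<not> b)) w) @ w) []"
  using assms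
proof (induction w)
  case Nil
  show ?case by (simp add: pres_eq.refl)
next
  case (Cons a w)
  obtain s b where a: "a = (s, b)" "s \<in> S" using Cons by (cases a) auto
  let ?v = "rev (map (\<lambda>(s, b). (s, \<not> b)) w)"
  have v: "pres_eq S R ?v ?v" and w: "pres_eq S R w w"
    using Cons by (auto intro!: pres_eq.refl)
  have "pres_eq S R [(s, \<not> b), (s, \<not> \<not> b)] []" using a by (intro pres_eq.cancel)
  from pres_eq.app[OF v pres_eq.app[OF this w]]
  have "pres_eq S R (?v @ [(s, \<not> b), (s, b)] @ w) (?v @ w)" by simp
  from pres_eq.trans[OF this] Cons show ?case by (auto simp: a)
qed

lemma group_presented_group: "group (presented_group S R)"
proof (rule groupI)
  let ?G = "presented_group S R" and ?W = "lists (S \<times> (UNIV :: bool set))"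
  let ?c = "\<lambda>w. pres_rel S R `` {w}"
  have car: "carrier ?G = ?c ` ?W" by (auto simp: presented_group_def quotient_def)
  have one: "\<one>\<^bsub>?G\<^esub> = ?c []" by (simp add: presented_group_def)
  show "x \<otimes>\<^bsub>?G\<^esub> y \<in> carrier ?G" if xy: "x \<in> carrier ?G" "y \<in> carrier ?G" for x y
  proof -
    obtain u where "x = ?c u" "u \<in> ?W" using xy(1) unfolding car by blast
    moreover obtain v where "y = ?c v" "v \<in> ?W" using xy(2) unfolding car by blast
    ultimately have "x \<otimes>\<^bsub>?G\<^esub> y = ?c (u @ v)" "u @ v \<in> ?W"
      by (simp_all add: presented_group_mult del: in_lists_conv_set)
    then show ?thesis unfolding car by blast
  qed
  show "\<one>\<^bsub>?G\<^esub> \<in> carrier ?G" by (auto simp: car one)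
  show "x \<otimes>\<^bsub>?G\<^esub> y \<otimes>\<^bsub>?G\<^esub> z = x \<otimes>\<^bsub>?G\<^esub> (y \<otimes>\<^bsub>?G\<^esub> z)"
    if xyz: "x \<in> carrier ?G" "y \<in> carrier ?G" "z \<in> carrier ?G" for x y z
  proof -
    obtain u where "x = ?c u" "u \<in> ?W" using xyz(1) unfolding car by blast
    moreover obtain v where "y = ?c v" "v \<in> ?W" using xyz(2) unfolding car by blast
    moreover obtain w where "z = ?c w" "w \<in> ?W" using xyz(3) unfolding car by blast
    ultimately show ?thesis by (simp add: presented_group_mult del: in_lists_conv_set)
  qed
  show "\<one>\<^bsub>?G\<^esub> \<otimes>\<^bsub>?G\<^esub> x = x" if x: "x \<in> carrier ?G" for x
  proof -
    obtain u where "x = ?c u" "u \<in> ?W" using x unfolding car by blast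
    then show ?thesis by (simp add: one presented_group_mult del: in_lists_conv_set)
  qed
  show "\<exists>y\<in>carrier ?G. y \<otimes>\<^bsub>?G\<^esub> x = \<one>\<^bsub>?G\<^esub>" if x: "x \<in> carrier ?G" for x
  proof -
    obtain u where u: "x = ?c u" "u \<in> ?W" using x unfolding car by blast
    let ?v = "rev (map (\<lambda>(s, b). (s, \<not> b)) u)"
    have v: "?v \<in> ?W" using u by auto
    have "?c (?v @ u) = ?c []"
      by (rule equiv_class_eq[OF equiv_pres_rel])
         (use pres_eq_inverse[OF u(2)] in \<open>simp add: pres_rel_def\<close>)
    then have "?c ?v \<otimes>\<^bsub>?G\<^esub> x = \<one>\<^bsub>?G\<^esub>"
      using presented_group_mult[OF v u(2)] by (simp add: u(1) one)
    then show ?thesis unfolding car using v by blast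
  qed
qed


section \<open>Braid groups and their homomorphisms to symmetric groups\<close>

definition pos_word :: "'a list \<Rightarrow> 'a gword" where
  "pos_word = map (\<lambda>s. (s, True))"

definition braid_relations :: "nat \<Rightarrow> (nat gword \<times> nat gword) set" where
  "braid_relations k =
     {(pos_word [i, j], pos_word [j, i]) | i j.
        i \<in> {1..k - 1} \<and> j \<in> {1..k - 1} \<and> 2 \<le> \<bar>int i - int j\<bar>}
   \<union> {(pos_word [i, i + 1, i], pos_word [i + 1, i, i + 1]) | i.
        i \<in> {1..k - 1} \<and> i + 1 \<in> {1..k - 1}}"

definition braid_group :: "nat \<Rightarrow> nat gword set monoid" where
  "braid_group k = presented_group {1..k - 1} (braid_relations k)"

definition braid_gen :: "nat \<Rightarrow> nat \<Rightarrow> nat gword set" where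
  "braid_gen k i = pres_rel {1..k - 1} (braid_relations k) `` {pos_word [i]}"

text \<open>The assignment \<open>\<sigma>\<^sub>i \<mapsto> f i\<close> defines a homomorphism to the symmetric group on \<open>{1..n}\<close> iff the
  following set has exactly one element. Extensionality fixes the irrelevant values outside
  the carrier.\<close>

definition homs_extending :: "nat \<Rightarrow> nat \<Rightarrow> (nat \<Rightarrow> nat \<Rightarrow> nat) \<Rightarrow> (nat gword set \<Rightarrow> nat \<Rightarrow> nat) set" where
  "homs_extending k n f =
     {h \<in> hom (braid_group k) (sym_group n) \<inter> extensional (carrier (braid_group k)).
        \<forall>i\<in>{1..k - 1}. h (braid_gen k i) = f i}"

definition cyclic_hom :: "nat \<Rightarrow> nat \<Rightarrow> (nat gword set \<Rightarrow> nat \<Rightarrow> nat) \<Rightarrow> bool" where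
  "cyclic_hom k n h \<longleftrightarrow> cyclic_group ((sym_group n)\<lparr>carrier := h ` carrier (braid_group k)\<rparr>)"

definition transitive_hom :: "nat \<Rightarrow> nat \<Rightarrow> (nat gword set \<Rightarrow> nat \<Rightarrow> nat) \<Rightarrow> bool" where
  "transitive_hom k n h \<longleftrightarrow>
     (\<forall>x\<in>{1..n}. \<forall>y\<in>{1..n}. \<exists>g\<in>carrier (braid_group k). h g x = y)"


section \<open>The permutations\<close>

definition pt :: "nat \<Rightarrow> nat \<Rightarrow> nat \<Rightarrow> nat" where
  "pt n i q = 1 + n * (i - 1) + q"

definition block_cycle :: "nat \<Rightarrow> nat \<Rightarrow> nat \<Rightarrow> nat" where
  "block_cycle n i = cycle_of_list [1 + n * (i - 1)..<n * i + 1]"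

text \<open>Here \<open>\<sigma>\<close> is a permutation of \<open>{j..j + r - 1}\<close>. A point \<open>x = pt n i q\<close> with \<open>1 \<le> i\<close> and \<open>q < n\<close>
  has block index \<open>i = (x - 1) div n + 1\<close> and offset \<open>q = (x - 1) mod n\<close>; see
  \<open>block_perm_pt\<close> below.\<close>

definition block_perm :: "(nat \<Rightarrow> nat) \<Rightarrow> nat \<Rightarrow> nat \<Rightarrow> nat \<Rightarrow> (nat \<Rightarrow> nat) \<Rightarrow> nat \<Rightarrow> nat" where
  "block_perm \<sigma> n j r t x =
     (if x \<in> {n * (j - 1) + 1..n * (j + r - 1)}
      then let i = (x - 1) div n + 1; q = (x - 1) mod n
           in pt n (\<sigma> i) ((q + t (\<sigma> i)) mod n)
      else x)"

lemma block_perm_pt: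
  assumes "1 \<le> j" "i \<in> {j..j + r - 1}" "q < n"
  shows "block_perm \<sigma> n j r t (pt n i q) = pt n (\<sigma> i) ((q + t (\<sigma> i)) mod n)"
proof -
  have "n * (j - 1) \<le> n * (i - 1)" using assms by (intro mult_le_mono) auto
  moreover have "n * (i - 1) + q < n * (j + r - 1)"
  proof -
    have "n * (i - 1) + q < n * (i - 1) + n" using assms by simp
    also have "\<dots> = n * i" using assms by (cases i) auto
    also have "\<dots> \<le> n * (j + r - 1)" using assms by (intro mult_le_mono) auto
    finally show ?thesis .
  qed
  ultimately have "pt n i q \<in> {n * (j - 1) + 1..n * (j + r - 1)}"
    unfolding pt_def atLeastAtMost_iff by linarith
  moreover have "(pt n i q - 1) div n + 1 = i" "(pt n i q - 1) mod n = q"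
    using assms by (simp_all add: pt_def)
  ultimately show ?thesis by (simp add: block_perm_def Let_def)
qed

definition psi :: "nat \<Rightarrow> nat \<Rightarrow> nat \<Rightarrow> nat" where
  "psi l i = cycle_of_list (concat (map (\<lambda>q. [pt l i q, pt l (i + 1) q]) [0..<l]))"

definition comp_list :: "('a \<Rightarrow> 'a) list \<Rightarrow> 'a \<Rightarrow> 'a" where
  "comp_list fs = foldr (\<circ>) fs id"

definition phi :: "nat \<Rightarrow> nat \<Rightarrow> nat \<Rightarrow> (nat \<Rightarrow> nat \<Rightarrow> nat) \<Rightarrow> nat \<Rightarrow> nat \<Rightarrow> nat" where
  "phi k m l t i =
     comp_list (map (block_cycle (m div l)) [1..<(i - 1) * l + 1])
     \<circ> block_perm (psi l i) (m div l) ((i - 1) * l + 1) (2 * l) (t i)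
     \<circ> comp_list (map (block_cycle (m div l)) [(i + 1) * l + 1..<k * l + 1])"

end

theory Submission
  imports Defs
begin

text \<open>
  Write the points of \<open>{1..m * k}\<close> as triples \<open>(b, q, r)\<close> with \<open>q\<close> modulo \<open>l\<close> and \<open>r\<close> modulo
  \<open>n = m div l\<close>. The \<open>i\<close>-th generator swaps the blocks \<open>b = i\<close> and \<open>b = i + 1\<close>, increases \<open>q\<close> by one
  on the way back, and translates \<open>r\<close> by an amount depending on the target; on all other blocks it adds
  one to \<open>r\<close>. Both sides of a braid relation then induce the same map on \<open>(b, q)\<close>, and their
  translations of \<open>r\<close> agree automatically except on the middle block, where equality is the congruence
  imposed on \<open>t\<close>. The image is not abelian because the first two generators do not commute on
  block 1. It is transitive since squares of generators rotate \<open>q\<close>, and for every block there is a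
  generator that only rotates \<open>r\<close> there.
\<close>

section \<open>The universal property of a presented group\<close>

definition eval_word :: "('g, 'x) monoid_scheme \<Rightarrow> ('a \<Rightarrow> 'g) \<Rightarrow> 'a gword \<Rightarrow> 'g" where
  "eval_word G f w =
     foldr (\<lambda>(s, b) x. (if b then f s else inv\<^bsub>G\<^esub> f s) \<otimes>\<^bsub>G\<^esub> x) w \<one>\<^bsub>G\<^esub>"

lemma eval_word_Nil [simp]: "eval_word G f [] = \<one>\<^bsub>G\<^esub>"
  by (simp add: eval_word_def)

lemma eval_word_Cons [simp]:
  "eval_word G f ((s, b) # w) = (if b then f s else inv\<^bsub>G\<^esub> f s) \<otimes>\<^bsub>G\<^esub> eval_word G f w"
  by (simp add: eval_word_def)

context group
begin

lemma eval_word_closed: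
  assumes "f \<in> S \<rightarrow> carrier G" "w \<in> lists (S \<times> UNIV)"
  shows "eval_word G f w \<in> carrier G"
  using assms(2)
proof (induction w)
  case (Cons a w)
  then show ?case using assms(1) by (cases a) auto
qed simp

lemma eval_word_append:
  assumes "f \<in> S \<rightarrow> carrier G" "u \<in> lists (S \<times> UNIV)" "v \<in> lists (S \<times> UNIV)"
  shows "eval_word G f (u @ v) = eval_word G f u \<otimes> eval_word G f v"
  using assms(2)
proof (induction u)
  case Nil
  then show ?case using eval_word_closed[OF assms(1,3)] by simp
next
  case (Cons a u)
  then show ?case
    using assms(1) eval_word_closed[OF assms(1)] assms(3)
    by (cases a) (auto simp: m_assoc Pi_iff simp del: in_lists_conv_set)
qed

text \<open>Induction over the congruence: evaluation is multiplicative, sends a letter followed by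
  its formal inverse to the unit, and respects \<open>R\<close> by assumption. This makes evaluation
  well defined on the classes of words.\<close>

lemma eval_word_pres_eq:
  assumes f: "f \<in> S \<rightarrow> carrier G"
    and R: "\<And>u v. (u, v) \<in> R \<Longrightarrow> eval_word G f u = eval_word G f v"
    and "pres_eq S R u v"
  shows "eval_word G f u = eval_word G f v"
  using assms(3)
proof induction
  case (app u u' v v')
  then show ?case
    using pres_eq_words[OF app.hyps(1)] pres_eq_words[OF app.hyps(2)]
    by (simp add: eval_word_append[OF f] del: in_lists_conv_set)
next
  case (cancel s b)
  then show ?case using f by (auto simp: Pi_iff)
qed (use R in auto)

lemma presented_group_hom_unique:
  assumes f: "f \<in> S \<rightarrow> carrier G"
    and h: "h \<in> hom (presented_group S R) G"
    and gen: "\<And>s. s \<in> S \<Longrightarrow> h (pres_rel S R `` {[(s, True)]}) = f s"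
    and w: "w \<in> lists (S \<times> UNIV)"
  shows "h (pres_rel S R `` {w}) = eval_word G f w"
proof -
  let ?P = "presented_group S R" and ?c = "\<lambda>w. pres_rel S R `` {w}"
  interpret P: group ?P by (rule group_presented_group)
  interpret h: group_hom ?P G h
    by unfold_locales (rule h)
  have car: "?c u \<in> carrier ?P" if "u \<in> lists (S \<times> UNIV)" for u
    using that by (auto simp: presented_group_def quotient_def)
  have one: "?c [] = \<one>\<^bsub>?P\<^esub>" by (simp add: presented_group_def)
  have letter: "h (?c [(s, b)]) = (if b then f s else inv f s)" if s: "s \<in> S" for s b
  proof (cases b)
    case True
    then show ?thesis using gen s by simp
  next
    case False
    \<comment> \<open>A homomorphism is prescribed only on the generators. The class of the formal
      inverse is a left inverse of the class of \<open>s\<close>, which forces its image to be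
      \<open>inv f s\<close>.\<close>
    have "?c [(s, False)] \<otimes>\<^bsub>?P\<^esub> ?c [(s, True)] = ?c ([(s, False)] @ [(s, True)])"
      by (rule presented_group_mult) (use s in auto)
    also have "\<dots> = \<one>\<^bsub>?P\<^esub>"
      unfolding one[symmetric]
      by (rule equiv_class_eq[OF equiv_pres_rel])
         (use pres_eq.cancel[OF s, of R False] in \<open>simp add: pres_rel_def\<close>)
    finally have "h (?c [(s, False)]) \<otimes> h (?c [(s, True)]) = \<one>"
      using car s by (simp flip: h.hom_mult)
    then have "inv (h (?c [(s, True)])) = h (?c [(s, False)])"
      by (rule inv_equality) (use car s in auto)
    then show ?thesis using gen s False by simp
  qed
  show ?thesis using w
  proof (induction w)
    case Nil
    then show ?case by (simp add: one)
  next
    case (Cons a w)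
    obtain s b where a: "a = (s, b)" "s \<in> S" using Cons by (cases a) auto
    have w: "w \<in> lists (S \<times> UNIV)" and s: "[(s, b)] \<in> lists (S \<times> UNIV)" using Cons a by auto
    have "h (?c ((s, b) # w)) = h (?c [(s, b)] \<otimes>\<^bsub>?P\<^esub> ?c w)"
      using presented_group_mult[OF s w, of R] by simp
    also have "\<dots> = h (?c [(s, b)]) \<otimes> h (?c w)"
      by (rule h.hom_mult) (intro car s w)+
    finally show ?case using Cons.IH letter a by simp
  qed
qed

text \<open>Von Dyck's theorem. Existence comes from evaluating representatives; uniqueness holds
  because letters determine all words, while \<open>extensional\<close> pins down the values outside
  the carrier.\<close>

lemma presented_group_hom_ex1:
  assumes f: "f \<in> S \<rightarrow> carrier G"
    and R: "\<And>u v. (u, v) \<in> R \<Longrightarrow> eval_word G f u = eval_word G f v"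
  shows "\<exists>!h. h \<in> hom (presented_group S R) G \<inter> extensional (carrier (presented_group S R))
           \<and> (\<forall>s\<in>S. h (pres_rel S R `` {[(s, True)]}) = f s)"
proof -
  let ?P = "presented_group S R" and ?c = "\<lambda>w. pres_rel S R `` {w}" and ?W = "lists (S \<times> UNIV)"
  have car: "carrier ?P = ?c ` ?W" by (auto simp: presented_group_def quotient_def)
  \<comment> \<open>Each class is evaluated at an arbitrary representative;
    \<open>eval_word_pres_eq\<close> shows that the choice does not matter.\<close>
  define h where
    "h = restrict (\<lambda>A. eval_word G f (SOME w. w \<in> A)) (carrier ?P)"
  have h: "h (?c w) = eval_word G f w" if w: "w \<in> ?W" for w
  proof -
    have "w \<in> ?c w" using w by (auto simp: pres_rel_def intro: pres_eq.refl)
    then have "(SOME w'. w' \<in> ?c w) \<in> ?c w" by (rule someI)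
    then have "pres_eq S R w (SOME w'. w' \<in> ?c w)" by (simp add: pres_rel_def)
    from eval_word_pres_eq[OF f R this] show ?thesis using w by (simp add: h_def car del: in_lists_conv_set)
  qed
  have hom: "h \<in> hom ?P G"
  proof (rule homI)
    show "h x \<in> carrier G" if "x \<in> carrier ?P" for x
    proof -
      obtain w where w: "x = ?c w" "w \<in> ?W" using \<open>x \<in> carrier ?P\<close> unfolding car by blast
      then show ?thesis using h[OF w(2)] eval_word_closed[OF f w(2)] by simp
    qed
    show "h (x \<otimes>\<^bsub>?P\<^esub> y) = h x \<otimes> h y" if xy: "x \<in> carrier ?P" "y \<in> carrier ?P" for x y
    proof -
      obtain u where u: "x = ?c u" "u \<in> ?W" using xy(1) unfolding car by blast
      obtain v where v: "y = ?c v" "v \<in> ?W" using xy(2) unfolding car by blast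
      have "u @ v \<in> ?W" using u v by auto
      then show ?thesis
        using u v h by (simp add: presented_group_mult eval_word_append[OF f] del: in_lists_conv_set)
    qed
  qed
  have gen: "h (?c [(s, True)]) = f s" if "s \<in> S" for s
  proof -
    have "h (?c [(s, True)]) = eval_word G f [(s, True)]" by (rule h) (use that in auto)
    then show ?thesis using f that by (auto simp: Pi_iff)
  qed
  show ?thesis
  proof (rule ex1I[of _ h])
    show "h \<in> hom ?P G \<inter> extensional (carrier ?P) \<and> (\<forall>s\<in>S. h (?c [(s, True)]) = f s)"
      using hom gen by (auto simp: h_def)
  next
    fix h' assume h': "h' \<in> hom ?P G \<inter> extensional (carrier ?P) \<and> (\<forall>s\<in>S. h' (?c [(s, True)]) = f s)"
    show "h' = h"
    proof (rule extensionalityI[of _ "carrier ?P"])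
      show "h' \<in> extensional (carrier ?P)" "h \<in> extensional (carrier ?P)"
        using h' by (auto simp: h_def)
      show "h' x = h x" if x: "x \<in> carrier ?P" for x
      proof -
        obtain w where w: "x = ?c w" "w \<in> ?W" using x unfolding car by blast
        then show ?thesis
          using presented_group_hom_unique[OF f _ _ w(2), of h' R] h' h by simp
      qed
    qed
  qed
qed

end

section \<open>Homomorphisms from braid groups to symmetric groups\<close>

lemma homs_extending_ex1:
  assumes perm: "\<And>i. i \<in> {1..k - 1} \<Longrightarrow> f i permutes {1..N}"
    and comm: "\<And>i j. \<lbrakk>i \<in> {1..k - 1}; j \<in> {1..k - 1}; 2 \<le> \<bar>int i - int j\<bar>\<rbrakk> \<Longrightarrow> f i \<circ> f j = f j \<circ> f i"
    and braid: "\<And>i. \<lbrakk>i \<in> {1..k - 1}; i + 1 \<in> {1..k - 1}\<rbrakk> \<Longrightarrow>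
      f i \<circ> f (i + 1) \<circ> f i = f (i + 1) \<circ> f i \<circ> f (i + 1)"
  shows "\<exists>!h. h \<in> homs_extending k N f"
proof -
  interpret group "sym_group N" by (rule sym_group_is_group)
  have "f \<in> {1..k - 1} \<rightarrow> carrier (sym_group N)"
    using perm by (simp add: sym_group_carrier)
  \<comment> \<open>Both sides of every braid relation are positive words, so they evaluate to plain
    composites and no inverse has to be computed.\<close>
  moreover have "eval_word (sym_group N) f u = eval_word (sym_group N) f v"
    if "(u, v) \<in> braid_relations k" for u v
    using that unfolding braid_relations_def
    by (auto simp: pos_word_def sym_group_mult sym_group_one)
       (use comm braid in \<open>simp_all add: comp_assoc\<close>)
  ultimately show ?thesis
    using presented_group_hom_ex1[of f "{1..k - 1}" "braid_relations k"]
    unfolding homs_extending_def braid_group_def braid_gen_def pos_word_def mem_Collect_eq by simp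
qed

section \<open>Points of the blocks\<close>

text \<open>An offset \<open>q < n\<close> never crosses a block boundary, so membership in a union
  of whole blocks is decided by the block index. It serves at both levels: blocks of length
  \<open>n\<close>, and blocks of length \<open>l\<close> among the indices of the former.\<close>

lemma pt_in_iff:
  assumes "0 < i" "q < n"
  shows "pt n i q \<in> {n * a + 1..n * b} \<longleftrightarrow> i \<in> {a + 1..b}"
proof -
  obtain i' where i: "i = Suc i'" using assms(1) by (cases i) auto
  have "n * a \<le> n * i' + q \<longleftrightarrow> a \<le> i'"
  proof
    assume "n * a \<le> n * i' + q"
    also have "\<dots> < n * Suc i'" using assms by simp
    finally show "a \<le> i'" by (simp only: mult_less_cancel1) simp
  next
    assume "a \<le> i'"
    then have "n * a \<le> n * i'" by (rule mult_le_mono2)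
    then show "n * a \<le> n * i' + q" by (rule trans_le_add1)
  qed
  moreover have "n * i' + q < n * b \<longleftrightarrow> i' < b"
  proof
    assume "n * i' + q < n * b"
    then have "n * i' < n * b" by (rule add_lessD1)
    then show "i' < b" by (simp only: mult_less_cancel1)
  next
    assume "i' < b"
    then have "n * Suc i' \<le> n * b" by (intro mult_le_mono2) simp
    then show "n * i' + q < n * b" using assms by simp
  qed
  ultimately show ?thesis by (auto simp: pt_def i)
qed

lemma pt_eqD:
  assumes "pt n i q = pt n j r" "0 < i" "0 < j" "q < n" "r < n"
  shows "i = j \<and> q = r"
proof -
  have "n * (i - 1) + q = n * (j - 1) + r" using assms by (simp add: pt_def)
  then have "(n * (i - 1) + q) div n = (n * (j - 1) + r) div n"
    "(n * (i - 1) + q) mod n = (n * (j - 1) + r) mod n" by auto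
  then show ?thesis using assms by auto
qed

lemma pt_eq_iff [simp]:
  assumes "0 < i" "0 < j" "q < n" "r < n"
  shows "pt n i q = pt n j r \<longleftrightarrow> i = j \<and> q = r"
  using pt_eqD[OF _ assms] by auto

lemma pt_pos [simp]: "0 < pt n i q"
  by (simp add: pt_def)

lemma pt_cases:
  assumes "x \<in> {n * a + 1..n * b}"
  obtains i q where "i \<in> {a + 1..b}" "q < n" "x = pt n i q"
proof -
  have n: "0 < n" using assms by (cases n) auto
  have x: "x = pt n ((x - 1) div n + 1) ((x - 1) mod n)"
    using assms by (simp add: pt_def)
  have "(x - 1) div n + 1 \<in> {a + 1..b}"
    by (rule iffD1[OF pt_in_iff[where q = "(x - 1) mod n" and n = n]])
       (use assms n in \<open>simp_all only: flip: x, simp_all\<close>)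
  then show ?thesis by (rule that[OF _ _ x]) (use n in simp)
qed

section \<open>Cycles and block permutations on points\<close>

lemma cycle_of_list_nth:
  assumes "distinct cs" "i < length cs"
  shows "cycle_of_list cs (cs ! i) = cs ! (Suc i mod length cs)"
proof -
  have "map (cycle_of_list cs) cs ! i = rotate1 cs ! i"
    using cyclic_rotation[OF assms(1), of 1] by simp
  then show ?thesis using assms by (simp add: nth_rotate1)
qed

lemma block_cycle_permutes: "block_cycle n i permutes {n * (i - 1) + 1..n * i}"
  using cycle_permutes[of "[1 + n * (i - 1)..<n * i + 1]"]
  by (simp add: block_cycle_def atLeastLessThanSuc_atLeastAtMost del: upt_Suc)

text \<open>Position \<open>q\<close> of the list defining the cycle holds \<open>pt n i q\<close>,
  so moving along the list adds one to the offset, modulo \<open>n\<close>.\<close>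

lemma block_cycle_pt:
  assumes "0 < i" "0 < j" "q < n"
  shows "block_cycle n j (pt n i q) = pt n i (if i = j then (q + 1) mod n else q)"
proof (cases "i = j")
  case True
  let ?cs = "[1 + n * (i - 1)..<n * i + 1]"
  have len: "length ?cs = n" using assms by (cases i) auto
  have nth: "?cs ! q = pt n i q" if "q < n" for q
  proof -
    have "1 + n * (i - 1) + q < n * i + 1" using that assms by (cases i) auto
    then show ?thesis by (simp add: pt_def del: upt_Suc)
  qed
  have n: "0 < n" using assms by simp
  have "cycle_of_list ?cs (?cs ! q) = ?cs ! (Suc q mod n)"
    using cycle_of_list_nth[of ?cs q] assms len by (simp del: upt_Suc)
  then show ?thesis
    unfolding block_cycle_def True[symmetric] nth[OF assms(3)] nth[OF mod_less_divisor[OF n]]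
    by simp
next
  case False
  then have "pt n i q \<notin> {n * (j - 1) + 1..n * j}"
    using assms by (subst pt_in_iff) auto
  then show ?thesis using permutes_not_in[OF block_cycle_permutes] False by simp
qed

lemma comp_list_Cons [simp]: "comp_list (f # fs) = f \<circ> comp_list fs"
  and comp_list_Nil [simp]: "comp_list [] = id"
  by (simp_all add: comp_list_def)

lemma comp_list_permutes:
  assumes "\<And>f. f \<in> set fs \<Longrightarrow> f permutes S"
  shows "comp_list fs permutes S"
  using assms by (induction fs) (auto intro: permutes_compose permutes_id)

text \<open>Every factor preserves block indices and moves only its own block. As the indices are
  distinct, a point is moved by at most one factor.\<close>

lemma comp_block_cycles_pt:
  assumes "distinct js" "0 \<notin> set js" "0 < i" "q < n"
  shows "comp_list (map (block_cycle n) js) (pt n i q)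
    = pt n i (if i \<in> set js then (q + 1) mod n else q)"
  using assms by (induction js) (auto simp: block_cycle_pt)

text \<open>Injectivity: the target block determines the source block because \<sigma> is injective,
  and since the translation depends only on the target block, it cancels modulo \<open>n\<close>. An
  injective self-map of a finite set is onto.\<close>

lemma block_perm_permutes:
  assumes \<sigma>: "\<sigma> permutes {j..j + r - 1}" and j: "1 \<le> j"
  shows "block_perm \<sigma> n j r t permutes {n * (j - 1) + 1..n * (j + r - 1)}"
    (is "?p permutes ?S")
proof (rule bij_imp_permutes)
  have \<sigma>': "\<sigma> i \<in> {j..j + r - 1}" if "i \<in> {j..j + r - 1}" for i
    using permutes_in_image[OF \<sigma>, of i] that by blast
  have S: "\<exists>i q. i \<in> {j..j + r - 1} \<and> q < n \<and> x = pt n i q" if x: "x \<in> ?S" for x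
  proof -
    obtain i q where "i \<in> {j - 1 + 1..j + r - 1}" "q < n" "x = pt n i q"
      using pt_cases[OF x] by blast
    then show ?thesis using j by auto
  qed
  have img: "?p x \<in> ?S" if x: "x \<in> ?S" for x
  proof -
    obtain i q where iq: "i \<in> {j..j + r - 1}" "q < n" "x = pt n i q" using S[OF x] by blast
    have "?p x = pt n (\<sigma> i) ((q + t (\<sigma> i)) mod n)"
      using iq block_perm_pt[OF j iq(1,2)] by simp
    also have "\<dots> \<in> ?S" using \<sigma>'[OF iq(1)] iq j by (subst pt_in_iff) auto
    finally show ?thesis .
  qed
  have inj: "inj_on ?p ?S"
  proof (rule inj_onI)
    fix x y assume xy: "x \<in> ?S" "y \<in> ?S" "?p x = ?p y"
    obtain i q where iq: "i \<in> {j..j + r - 1}" "q < n" "x = pt n i q" using S[OF xy(1)] by blast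
    obtain i' q' where iq': "i' \<in> {j..j + r - 1}" "q' < n" "y = pt n i' q'" using S[OF xy(2)] by blast
    have "pt n (\<sigma> i) ((q + t (\<sigma> i)) mod n) = pt n (\<sigma> i') ((q' + t (\<sigma> i')) mod n)"
      using xy(3) iq iq' block_perm_pt[OF j iq(1,2)] block_perm_pt[OF j iq'(1,2)] by simp
    then have "\<sigma> i = \<sigma> i' \<and> (q + t (\<sigma> i)) mod n = (q' + t (\<sigma> i')) mod n"
      by (rule pt_eqD) (use \<sigma>'[OF iq(1)] \<sigma>'[OF iq'(1)] iq iq' j in auto)
    moreover from this have "i = i'" using permutes_inj[OF \<sigma>] by (auto dest: injD)
    ultimately have "[q + t (\<sigma> i) = q' + t (\<sigma> i)] (mod n)" "i = i'"
      by (auto simp: cong_def)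
    then have "[q = q'] (mod n)" "i = i'" by (simp_all only: cong_add_rcancel_nat)
    then have "q = q'" "i = i'" using iq(2) iq'(2) by (simp_all add: cong_def)
    then show "x = y" using iq iq' by simp
  qed
  have "?p ` ?S = ?S" by (rule endo_inj_surj[OF _ _ inj]) (use img in blast)+
  then show "bij_betw ?p ?S ?S" using inj by (simp only: bij_betw_def)
  show "?p x = x" if "x \<notin> ?S" for x using that unfolding block_perm_def by (simp only: if_False)
qed


section \<open>The permutations on points\<close>

text \<open>Locates the points in the list behind \<open>psi\<close>: block \<open>i\<close>
  occupies the even positions, block \<open>i + 1\<close> the odd ones.\<close>

lemma nth_concat_pairs:
  assumes "q < l"
  shows "concat (map (\<lambda>q. [f q, g q]) [0..<l]) ! (2 * q) = f q"
    and "concat (map (\<lambda>q. [f q, g q]) [0..<l]) ! Suc (2 * q) = g q"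
proof -
  have "concat (map (\<lambda>q. [f q, g q]) [0..<l]) ! (2 * q) = f q
    \<and> concat (map (\<lambda>q. [f q, g q]) [0..<l]) ! Suc (2 * q) = g q"
    using assms
  proof (induction l)
    case (Suc l)
    have len: "length (concat (map (\<lambda>q. [f q, g q]) [0..<l])) = 2 * l" for l
      by (induction l) auto
    show ?case
    proof (cases "q = l")
      case True
      then show ?thesis using len[of l] by (simp add: nth_append)
    next
      case False
      then have "q < l" using Suc by simp
      then show ?thesis using Suc.IH len[of l] by (simp add: nth_append)
    qed
  qed simp
  then show "concat (map (\<lambda>q. [f q, g q]) [0..<l]) ! (2 * q) = f q"
    and "concat (map (\<lambda>q. [f q, g q]) [0..<l]) ! Suc (2 * q) = g q" by auto
qed

lemma distinct_psi_cycle: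
  assumes "0 < i"
  shows "distinct (concat (map (\<lambda>q. [pt l i q, pt l (i + 1) q]) [0..<l]))"
proof -
  \<comment> \<open>\<open>l\<close> is both the block length and the number of pairs; only the
    latter is generalised to \<open>l'\<close> for the induction.\<close>
  have "distinct (concat (map (\<lambda>q. [pt l i q, pt l (i + 1) q]) [0..<l']))" if "l' \<le> l" for l'
    using that assms by (induction l') auto
  then show ?thesis by simp
qed

lemma psi_pt_left:
  assumes "0 < i" "q < l"
  shows "psi l i (pt l i q) = pt l (Suc i) q"
proof -
  let ?cs = "concat (map (\<lambda>q. [pt l i q, pt l (i + 1) q]) [0..<l])"
  have len: "length ?cs = 2 * l" by (simp add: length_concat comp_def sum_list_triv)
  have "cycle_of_list ?cs (?cs ! (2 * q)) = ?cs ! (Suc (2 * q) mod (2 * l))"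
    using cycle_of_list_nth[OF distinct_psi_cycle[OF assms(1)], of "2 * q" l] assms len by simp
  \<comment> \<open>An even position is never the last one, so no wrap-around occurs.\<close>
  also have "Suc (2 * q) mod (2 * l) = Suc (2 * q)" using assms by simp
  finally show ?thesis unfolding nth_concat_pairs[OF assms(2)] by (simp add: psi_def)
qed

lemma psi_pt_right:
  assumes "0 < i" "q < l"
  shows "psi l i (pt l (Suc i) q) = pt l i (Suc q mod l)"
proof -
  let ?cs = "concat (map (\<lambda>q. [pt l i q, pt l (i + 1) q]) [0..<l])"
  have len: "length ?cs = 2 * l" by (simp add: length_concat comp_def sum_list_triv)
  have q': "Suc q mod l < l" using assms by simp
  have "cycle_of_list ?cs (?cs ! Suc (2 * q)) = ?cs ! (Suc (Suc (2 * q)) mod (2 * l))"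
    using cycle_of_list_nth[OF distinct_psi_cycle[OF assms(1)], of "Suc (2 * q)" l] assms len by simp
  \<comment> \<open>Wrapping around the list of length \<open>2 * l\<close> amounts to wrapping
    \<open>q\<close> modulo \<open>l\<close>; this is where the offset is raised.\<close>
  also have "Suc (Suc (2 * q)) mod (2 * l) = 2 * (Suc q mod l)"
    using mult_mod_right[of 2 "Suc q" l] by simp
  finally show ?thesis
    unfolding nth_concat_pairs[OF assms(2)] nth_concat_pairs(1)[OF q'] by (simp add: psi_def)
qed

lemma psi_permutes:
  assumes "0 < i"
  shows "psi l i permutes {l * (i - 1) + 1..l * (i + 1)}"
proof -
  let ?cs = "concat (map (\<lambda>q. [pt l i q, pt l (i + 1) q]) [0..<l])"
  have "x \<in> {l * (i - 1) + 1..l * (i + 1)}" if "x \<in> set ?cs" for x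
  proof -
    have "\<exists>q<l. x = pt l i q \<or> x = pt l (i + 1) q" using that by auto
    then obtain q where "q < l" "x = pt l i q \<or> x = pt l (i + 1) q" by blast
    then show ?thesis using assms pt_in_iff[of i q l "i - 1" "i + 1"] pt_in_iff[of "i + 1" q l "i - 1" "i + 1"]
      by auto
  qed
  then show ?thesis
    unfolding psi_def by (intro permutes_subset[OF cycle_permutes] subsetI)
qed

lemma psi_pt_other:
  assumes "0 < i" "0 < b" "q < l" "b \<noteq> i" "b \<noteq> Suc i"
  shows "psi l i (pt l b q) = pt l b q"
  by (rule permutes_not_in[OF psi_permutes]) (use assms in \<open>simp_all only: pt_in_iff, auto\<close>)

text \<open>The support of \<open>psi\<close> in the shape \<open>{j..j + r - 1}\<close>, with
  \<open>j = (i - 1) * l + 1\<close> and \<open>r = 2 * l\<close>, as required by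
  \<open>block_perm_permutes\<close>.\<close>

lemma psi_permutes_block:
  assumes "0 < i" "0 < l"
  shows "psi l i permutes {(i - 1) * l + 1..(i - 1) * l + 1 + 2 * l - 1}"
proof -
  have "(i - 1) * l + 1 + 2 * l - 1 = l * (i + 1)" using assms by (cases i) auto
  moreover have "(i - 1) * l = l * (i - 1)" by (rule mult.commute)
  ultimately show ?thesis using psi_permutes[OF assms(1), of l] by (simp only:)
qed

section \<open>The permutations \<open>phi\<close> on points\<close>

lemma phi_permutes:
  assumes "i \<in> {1..k - 1}" "0 < l" "l dvd m"
  shows "phi k m l t i permutes {1..m * k}"
proof -
  define n where "n = m div l"
  have m: "m = n * l" using assms by (simp add: n_def)
  have cyc: "block_cycle n j permutes {1..m * k}" if "j < k * l + 1" for j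
  proof (rule permutes_subset[OF block_cycle_permutes])
    have "n * j \<le> n * (k * l)" using that by (intro mult_le_mono2) simp
    then show "{n * (j - 1) + 1..n * j} \<subseteq> {1..m * k}" by (auto simp: m mult_ac)
  qed
  have le: "(i - 1) * l \<le> k * l" using assms by (intro mult_le_mono1) auto
  have "j < k * l + 1" if "j \<in> set [1..<(i - 1) * l + 1]" for j
    using that le unfolding set_upt atLeastLessThan_iff by linarith
  then have "comp_list (map (block_cycle n) [1..<(i - 1) * l + 1]) permutes {1..m * k}"
    using cyc by (intro comp_list_permutes) (auto simp only: set_map)
  moreover have "comp_list (map (block_cycle n) [(i + 1) * l + 1..<k * l + 1]) permutes {1..m * k}"
    by (intro comp_list_permutes) (use cyc in \<open>auto simp del: upt_Suc One_nat_def\<close>)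
  moreover have "block_perm (psi l i) n ((i - 1) * l + 1) (2 * l) (t i) permutes {1..m * k}"
  proof (rule permutes_subset[OF block_perm_permutes])
    show "psi l i permutes {(i - 1) * l + 1..(i - 1) * l + 1 + 2 * l - 1}"
      using assms by (intro psi_permutes_block) auto
    have "(i - 1) * l + 1 + 2 * l - 1 = (i + 1) * l" using assms by (cases i) auto
    also have "n * \<dots> \<le> n * (k * l)" using assms by (intro mult_le_mono) auto
    finally show "{n * ((i - 1) * l + 1 - 1) + 1..n * ((i - 1) * l + 1 + 2 * l - 1)} \<subseteq> {1..m * k}"
      by (auto simp: m mult_ac)
  qed simp
  ultimately show ?thesis
    unfolding phi_def n_def[symmetric] by (intro permutes_compose)
qed

text \<open>The three factors of \<open>phi\<close> act on disjoint ranges of blocks of length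
  \<open>n\<close>, and each preserves its range. Depending on the position of \<open>Q\<close>,
  exactly one of them applies and the other two fix the points met.\<close>

lemma phi_pt:
  assumes i: "i \<in> {1..k - 1}" and l: "0 < l" and n: "n = m div l"
    and Q: "Q \<in> {1..k * l}" and r: "r < n"
  shows "phi k m l t i (pt n Q r) =
    (if Q \<in> {(i - 1) * l + 1..(i + 1) * l}
     then pt n (psi l i Q) ((r + t i (psi l i Q)) mod n)
     else pt n Q ((r + 1) mod n))"
proof -
  let ?A = "comp_list (map (block_cycle n) [1..<(i - 1) * l + 1])"
  let ?B = "block_perm (psi l i) n ((i - 1) * l + 1) (2 * l) (t i)"
  let ?D = "comp_list (map (block_cycle n) [(i + 1) * l + 1..<k * l + 1])"
  have n0: "0 < n" using r by simp
  have e: "(i - 1) * l + 1 + 2 * l - 1 = (i + 1) * l" using i by (cases i) auto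
  have phi: "phi k m l t i x = ?A (?B (?D x))" for x
    by (simp add: phi_def n)
  have A: "?A (pt n Q' r') = pt n Q' (if Q' \<le> (i - 1) * l then (r' + 1) mod n else r')"
    if "0 < Q'" "r' < n" for Q' r'
    using that by (subst comp_block_cycles_pt) (auto simp del: upt_Suc)
  have D: "?D (pt n Q r) = pt n Q (if (i + 1) * l < Q then (r + 1) mod n else r)"
    using Q r by (subst comp_block_cycles_pt) (auto simp del: upt_Suc)
  note perm = psi_permutes_block[of i l, unfolded e]
  have le: "(i - 1) * l \<le> (i + 1) * l" by (intro mult_le_mono1) simp
  consider "Q \<le> (i - 1) * l" | "Q \<in> {(i - 1) * l + 1..(i + 1) * l}" | "(i + 1) * l < Q" by force
  then show ?thesis
  proof cases
    case 2
    have "psi l i Q \<in> {(i - 1) * l + 1..(i + 1) * l}"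
      using permutes_in_image[OF perm, of Q] 2 i l by auto
    then have "0 < psi l i Q" "\<not> psi l i Q \<le> (i - 1) * l" by auto
    moreover have "?B (pt n Q r) = pt n (psi l i Q) ((r + t i (psi l i Q)) mod n)"
    proof (rule block_perm_pt)
      show "Q \<in> {(i - 1) * l + 1..(i - 1) * l + 1 + 2 * l - 1}" unfolding e by (rule 2)
    qed (use r in auto)
    ultimately show ?thesis using 2 A D n0 by (simp add: phi)
  next
    case 1
    have "?B (pt n Q r) = pt n Q r"
    proof (rule permutes_not_in[OF block_perm_permutes[OF psi_permutes_block]])
      show "pt n Q r \<notin> {n * ((i - 1) * l + 1 - 1) + 1..n * ((i - 1) * l + 1 + 2 * l - 1)}"
        unfolding e using 1 Q r by (subst pt_in_iff) auto
    qed (use i l in auto)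
    then show ?thesis using 1 le A D Q r by (simp add: phi)
  next
    case 3
    have "?B (pt n Q ((r + 1) mod n)) = pt n Q ((r + 1) mod n)"
    proof (rule permutes_not_in[OF block_perm_permutes[OF psi_permutes_block]])
      show "pt n Q ((r + 1) mod n) \<notin> {n * ((i - 1) * l + 1 - 1) + 1..n * ((i - 1) * l + 1 + 2 * l - 1)}"
        unfolding e using 3 Q n0 by (subst pt_in_iff) auto
    qed (use i l in auto)
    then show ?thesis using 3 le A D Q n0 by (simp add: phi)
  qed
qed

section \<open>Braid homomorphisms from the action on points\<close>

text \<open>The parameters \<open>l = m\<close>, \<open>n = 1\<close> give the permutations \<open>psi m\<close>, and \<open>n = m div l\<close> gives
  the permutations \<open>phi k m l t\<close>.\<close>

locale braid_action =
  fixes k l n :: nat and t :: "nat \<Rightarrow> nat \<Rightarrow> nat" and f :: "nat \<Rightarrow> nat \<Rightarrow> nat"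
  assumes k: "4 \<le> k" and l: "0 < l" and n: "0 < n"
    and permutes: "\<And>i. i \<in> {1..k - 1} \<Longrightarrow> f i permutes {1..n * (l * k)}"
    and left: "\<And>i q r. \<lbrakk>i \<in> {1..k - 1}; q < l; r < n\<rbrakk> \<Longrightarrow>
      f i (pt n (pt l i q) r) = pt n (pt l (Suc i) q) ((r + t i (pt l (Suc i) q)) mod n)"
    and right: "\<And>i q r. \<lbrakk>i \<in> {1..k - 1}; q < l; r < n\<rbrakk> \<Longrightarrow>
      f i (pt n (pt l (Suc i) q) r) =
        pt n (pt l i (Suc q mod l)) ((r + t i (pt l i (Suc q mod l))) mod n)"
    and other: "\<And>i b q r. \<lbrakk>i \<in> {1..k - 1}; b \<in> {1..k}; b \<noteq> i; b \<noteq> Suc i; q < l; r < n\<rbrakk> \<Longrightarrow>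
      f i (pt n (pt l b q) r) = pt n (pt l b q) (Suc r mod n)"
    and compat: "\<And>i q. \<lbrakk>i \<in> {1..k - 2}; q < l\<rbrakk> \<Longrightarrow>
      [t i (pt l i (Suc q mod l)) + t i (pt l (Suc i) (Suc q mod l))
       = t (Suc i) (pt l (Suc (Suc i)) q) + t (Suc i) (pt l (Suc i) (Suc q mod l))] (mod n)"
begin

lemma point_cases:
  assumes "x \<in> {1..n * (l * k)}"
  obtains b q r where "b \<in> {1..k}" "q < l" "r < n" "x = pt n (pt l b q) r"
proof -
  obtain Q r where Q: "Q \<in> {0 + 1..l * k}" "r < n" "x = pt n Q r"
    using pt_cases[of x n 0 "l * k"] assms by auto
  obtain b q where "b \<in> {0 + 1..k}" "q < l" "Q = pt l b q"
    using pt_cases[of Q l 0 k] Q by auto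
  then show ?thesis using that Q by auto
qed

text \<open>The offset is written \<open>r mod n\<close> with arbitrary \<open>r\<close>, so that
  the rules \<open>left_mod\<close>, \<open>right_mod\<close> and \<open>other_mod\<close> can be
  chained: each right-hand side has again the form that the next rule expects, without a bound on
  \<open>r\<close>.\<close>

lemma permutation_eqI:
  assumes "p permutes {1..n * (l * k)}" "p' permutes {1..n * (l * k)}"
    and eq: "\<And>b q r. \<lbrakk>b \<in> {1..k}; q < l\<rbrakk> \<Longrightarrow>
      p (pt n (pt l b q) (r mod n)) = p' (pt n (pt l b q) (r mod n))"
  shows "p = p'"
proof
  fix x show "p x = p' x"
  proof (cases "x \<in> {1..n * (l * k)}")
    case True
    then obtain b q r where "b \<in> {1..k}" "q < l" "r < n" "x = pt n (pt l b q) r"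
      by (rule point_cases)
    then show ?thesis using eq[of b q r] by simp
  next
    case False
    then show ?thesis using permutes_not_in assms(1,2) by metis
  qed
qed

lemma left_mod:
  assumes "i \<in> {1..k - 1}" "q < l"
  shows "f i (pt n (pt l i q) (r mod n)) = pt n (pt l (Suc i) q) ((r + t i (pt l (Suc i) q)) mod n)"
  using left[OF assms, of "r mod n"] n by (simp add: mod_add_left_eq)

lemma right_mod:
  assumes "i \<in> {1..k - 1}" "q < l"
  shows "f i (pt n (pt l (Suc i) q) (r mod n)) =
    pt n (pt l i (Suc q mod l)) ((r + t i (pt l i (Suc q mod l))) mod n)"
  using right[OF assms, of "r mod n"] n by (simp add: mod_add_left_eq)

lemma other_mod:
  assumes "i \<in> {1..k - 1}" "b \<in> {1..k}" "b \<noteq> i" "b \<noteq> Suc i" "q < l"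
  shows "f i (pt n (pt l b q) (r mod n)) = pt n (pt l b q) ((r + 1) mod n)"
  using other[OF assms, of "r mod n"] n by (simp add: mod_Suc_eq)

text \<open>The two generators swap disjoint pairs of blocks. On a block that one of them moves, the
  other adds one to \<open>r\<close> before or after the move, and these additions commute.\<close>

lemma commute:
  assumes "i \<in> {1..k - 1}" "j \<in> {1..k - 1}" "2 \<le> \<bar>int i - int j\<bar>"
  shows "f i \<circ> f j = f j \<circ> f i"
proof (rule permutation_eqI)
  fix b q r assume bq: "b \<in> {1..k}" "q < l"
  have d: "i \<noteq> j" "j \<noteq> i" "Suc i \<noteq> j" "j \<noteq> Suc i" "i \<noteq> Suc j" "Suc j \<noteq> i" using assms by auto
  have blocks: "i \<in> {1..k}" "Suc i \<in> {1..k}" "j \<in> {1..k}" "Suc j \<in> {1..k}" using assms by auto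
  have q': "Suc q mod l < l" using l by simp
  note step = left_mod right_mod other_mod assms(1,2) bq d blocks q'
  consider "b = i" | "b = Suc i" | "b = j" | "b = Suc j"
    | "b \<noteq> i" "b \<noteq> Suc i" "b \<noteq> j" "b \<noteq> Suc j" by blast
  then show "(f i \<circ> f j) (pt n (pt l b q) (r mod n)) = (f j \<circ> f i) (pt n (pt l b q) (r mod n))"
    by cases (simp_all only: comp_apply step add_ac nat.inject not_False_eq_True simp_thms)
qed (use assms permutes in \<open>auto intro: permutes_compose\<close>)

lemma braid:
  assumes i: "i \<in> {1..k - 1}" "Suc i \<in> {1..k - 1}"
  shows "f i \<circ> f (Suc i) \<circ> f i = f (Suc i) \<circ> f i \<circ> f (Suc i)"
proof (rule permutation_eqI)
  fix b q r assume bq: "b \<in> {1..k}" "q < l"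
  have d: "i \<noteq> Suc i" "i \<noteq> Suc (Suc i)" "Suc (Suc i) \<noteq> i" "Suc (Suc i) \<noteq> Suc i" by auto
  have blocks: "i \<in> {1..k}" "Suc i \<in> {1..k}" "Suc (Suc i) \<in> {1..k}" using i by auto
  \<comment> \<open>Starting from block \<open>i + 2\<close>, both sides descend two blocks and
    raise \<open>q\<close> twice, hence the second bound.\<close>
  have q': "Suc q mod l < l" "Suc (Suc q mod l) mod l < l" using l by simp_all
  note step = left_mod right_mod other_mod i bq d blocks q'
  consider "b = i" | "b = Suc i" | "b = Suc (Suc i)"
    | "b \<noteq> i" "b \<noteq> Suc i" "b \<noteq> Suc (Suc i)" by blast
  then show "(f i \<circ> f (Suc i) \<circ> f i) (pt n (pt l b q) (r mod n)) =
    (f (Suc i) \<circ> f i \<circ> f (Suc i)) (pt n (pt l b q) (r mod n))"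
  proof cases
    case 2
    \<comment> \<open>Both sides end at block \<open>i + 1\<close> with \<open>q\<close> raised by
      one. The left one travels through block \<open>i\<close>, the right one through block
      \<open>i + 2\<close>, and in both the middle factor contributes the common summand 1. What
      remains is \<open>compat\<close>.\<close>
    have "[(r + 1) + (t i (pt l i (Suc q mod l)) + t i (pt l (Suc i) (Suc q mod l)))
       = (r + 1) + (t (Suc i) (pt l (Suc (Suc i)) q) + t (Suc i) (pt l (Suc i) (Suc q mod l)))] (mod n)"
      by (intro cong_add compat cong_refl) (use i bq in auto)
    then show ?thesis
      unfolding 2 cong_def by (simp only: comp_apply step not_False_eq_True simp_thms add_ac)
  qed (simp_all only: comp_apply step not_False_eq_True simp_thms add_ac)
qed (use i permutes in \<open>auto intro!: permutes_compose\<close>)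

section \<open>Existence, non-cyclicity and transitivity\<close>

lemma hom_ex1: "\<exists>!h. h \<in> homs_extending k (n * (l * k)) f"
  by (rule homs_extending_ex1) (use permutes commute braid in auto)

lemma braid_gen_carrier:
  assumes "i \<in> {1..k - 1}"
  shows "braid_gen k i \<in> carrier (braid_group k)"
  using assms by (auto simp: braid_gen_def braid_group_def presented_group_def pos_word_def
      intro!: quotientI)

lemma group_hom:
  assumes "h \<in> homs_extending k (n * (l * k)) f"
  shows "group_hom (braid_group k) (sym_group (n * (l * k))) h"
  using assms group_presented_group sym_group_is_group
  by (auto simp: homs_extending_def braid_group_def group_hom_def group_hom_axioms_def)

lemma not_cyclic:
  assumes h: "h \<in> homs_extending k (n * (l * k)) f"
  shows "\<not> cyclic_hom k (n * (l * k)) h"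
proof
  let ?S = "sym_group (n * (l * k))" and ?B = "braid_group k"
  let ?G = "?S\<lparr>carrier := h ` carrier ?B\<rparr>"
  interpret group_hom ?B ?S h by (rule group_hom[OF h])
  assume "cyclic_hom k (n * (l * k)) h"
  moreover have "group ?G"
    by (rule subgroup.subgroup_is_group[OF img_is_subgroup sym_group_is_group])
  ultimately interpret G: comm_group ?G
    unfolding cyclic_hom_def by (intro group.cyclic_imp_abelian_group)
  have "f i \<in> carrier ?G" if "i \<in> {1..k - 1}" for i
  proof -
    have "f i = h (braid_gen k i)" using h that by (simp add: homs_extending_def)
    then show ?thesis using braid_gen_carrier[OF that] by simp
  qed
  then have "f 1 \<in> carrier ?G" "f 2 \<in> carrier ?G" using k by auto
  then have "f 1 \<circ> f 2 = f 2 \<circ> f 1"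
    using G.m_comm[of "f 1" "f 2"] by (simp add: sym_group_mult)
  \<comment> \<open>Applying \<open>f 2\<close> first leaves the point in block 1, from where
    \<open>f 1\<close> takes it to block 2. In the other order it climbs to block 3, so the offsets
    need not be compared.\<close>
  then have "f 1 (f 2 (pt n (pt l 1 0) 0)) = f 2 (f 1 (pt n (pt l 1 0) 0))"
    by (metis comp_apply)
  moreover have "f 1 (f 2 (pt n (pt l 1 0) 0)) = pt n (pt l 2 0) ((1 + t 1 (pt l 2 0)) mod n)"
    using k l left_mod[of 1 0 1] other_mod[of 2 1 0 0]
    by (simp add: numeral_2_eq_2)
  moreover have "f 2 (f 1 (pt n (pt l 1 0) 0)) =
      pt n (pt l 3 0) ((t 1 (pt l 2 0) + t 2 (pt l 3 0)) mod n)"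
    using k l left_mod[of 1 0 0] left_mod[of 2 0 "t 1 (pt l 2 0)"]
    by (simp add: numeral_2_eq_2 numeral_3_eq_3)
  ultimately show False using l n by simp
qed

lemma transitive:
  assumes h: "h \<in> homs_extending k (n * (l * k)) f"
  shows "transitive_hom k (n * (l * k)) h"
proof -
  let ?S = "sym_group (n * (l * k))" and ?B = "braid_group k"
  interpret group_hom ?B ?S h by (rule group_hom[OF h])
  \<comment> \<open>As \<open>h\<close> is a homomorphism from a group, this is an equivalence
    relation, so it suffices to reach every point from the base point
    \<open>pt n (pt l 1 0) 0\<close>.\<close>
  define reach where "reach x y \<longleftrightarrow> (\<exists>g\<in>carrier ?B. h g x = y)" for x y
  have refl: "reach x x" for x
    unfolding reach_def by (rule bexI[of _ "\<one>\<^bsub>?B\<^esub>"]) (auto simp: sym_group_one)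
  have trans: "reach x z" if xy: "reach x y" and yz: "reach y z" for x y z
  proof -
    obtain g g' where g: "g \<in> carrier ?B" "h g x = y" "g' \<in> carrier ?B" "h g' y = z"
      using xy yz unfolding reach_def by blast
    show ?thesis unfolding reach_def
      by (rule bexI[of _ "g' \<otimes>\<^bsub>?B\<^esub> g"]) (use g in \<open>auto simp: sym_group_mult\<close>)
  qed
  have sym: "reach y x" if xy: "reach x y" for x y
  proof -
    obtain g where g: "g \<in> carrier ?B" "h g x = y" using xy unfolding reach_def by blast
    have "h (inv\<^bsub>?B\<^esub> g) \<circ> h g = id"
      using g hom_mult[of "inv\<^bsub>?B\<^esub> g" g] by (simp add: sym_group_mult sym_group_one)
    then have "h (inv\<^bsub>?B\<^esub> g) y = x" using g by (metis comp_apply id_apply)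
    then show ?thesis unfolding reach_def using g by blast
  qed
  have gen: "reach x (f i x)" if "i \<in> {1..k - 1}" for i x
    unfolding reach_def
    by (rule bexI[of _ "braid_gen k i"]) (use h that braid_gen_carrier in \<open>auto simp: homs_extending_def\<close>)
  have shift: "reach (pt n (pt l b q) r) (pt n (pt l b q) ((r + s) mod n))"
    if b: "b \<in> {1..k}" and q: "q < l" and r: "r < n" for b q r s
  proof (induction s)
    case 0
    then show ?case using refl r by simp
  next
    case (Suc s)
    \<comment> \<open>The generator \<open>j\<close> must leave block \<open>b\<close> in place:
      generator 3 swaps blocks 3 and 4, generator 1 swaps blocks 1 and 2. Index 3 is available
      because \<open>4 \<le> k\<close>.\<close>
    define j where "j = (if b \<le> 2 then 3 else 1 :: nat)"
    have "f j (pt n (pt l b q) ((r + s) mod n)) = pt n (pt l b q) ((r + s + 1) mod n)"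
      by (rule other_mod) (use b q k in \<open>auto simp: j_def\<close>)
    moreover have "reach (pt n (pt l b q) ((r + s) mod n)) (f j (pt n (pt l b q) ((r + s) mod n)))"
      by (rule gen) (use k in \<open>auto simp: j_def\<close>)
    ultimately show ?case using trans[OF Suc] by simp
  qed
  \<comment> \<open>Taking \<open>s = n - r + r'\<close> gives \<open>r + s = n + r'\<close>, which
    avoids the truncated difference \<open>r' - r\<close>.\<close>
  have rotate: "reach (pt n (pt l b q) r) (pt n (pt l b q) r')"
    if "b \<in> {1..k}" "q < l" "r < n" "r' < n" for b q r r'
    using shift[OF that(1-3), of "n - r + r'"] that by simp
  \<comment> \<open>The generator lands at an offset dictated by \<open>t\<close>;
    \<open>rotate\<close> resets it to 0, so the values of \<open>t\<close> need not be
    tracked.\<close>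
  have up: "reach (pt n (pt l b q) 0) (pt n (pt l (Suc b) q) 0)"
    if b: "b \<in> {1..k - 1}" and q: "q < l" for b q
  proof -
    have "reach (pt n (pt l b q) 0) (pt n (pt l (Suc b) q) ((0 + t b (pt l (Suc b) q)) mod n))"
      using gen[OF b, of "pt n (pt l b q) 0"] unfolding left[OF b q n] .
    then show ?thesis
      by (rule trans) (rule rotate, use b q n k in auto)
  qed
  \<comment> \<open>Going from block 1 to block 2 and back with \<open>f 1\<close> raises
    \<open>q\<close> by one.\<close>
  have first: "reach (pt n (pt l 1 0) 0) (pt n (pt l 1 q) 0)" if "q < l" for q
    using that
  proof (induction q)
    case (Suc q)
    have k1: "1 \<in> {1..k - 1}" using k by auto
    have q: "q < l" "Suc q mod l = Suc q" using Suc.prems by auto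
    have "reach (pt n (pt l (Suc 1) q) 0) (pt n (pt l 1 (Suc q)) ((0 + t 1 (pt l 1 (Suc q))) mod n))"
      using gen[OF k1, of "pt n (pt l (Suc 1) q) 0"] unfolding right[OF k1 q(1) n] q(2) .
    then have "reach (pt n (pt l (Suc 1) q) 0) (pt n (pt l 1 (Suc q)) 0)"
      by (rule trans) (rule rotate, use n k Suc.prems in auto)
    from trans[OF up[OF k1 q(1)] this] show ?case by (rule trans[OF Suc.IH[OF q(1)]])
  qed (rule refl)
  have all: "reach (pt n (pt l 1 0) 0) (pt n (pt l b q) 0)" if "b \<in> {1..k}" "q < l" for b q
    using that
  proof (induction b)
    case (Suc b)
    \<comment> \<open>The induction starts at 0, which is not a block; the actual base is block 1,
      where \<open>first\<close> applies.\<close>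
    show ?case
    proof (cases "b = 0")
      case True
      then show ?thesis using first Suc.prems by simp
    next
      case False
      have "reach (pt n (pt l 1 0) 0) (pt n (pt l b q) 0)" using Suc False by auto
      then show ?thesis by (rule trans) (rule up, use Suc.prems False in auto)
    qed
  qed simp
  have "reach (pt n (pt l 1 0) 0) x" if x: "x \<in> {1..n * (l * k)}" for x
  proof -
    obtain b q r where bqr: "b \<in> {1..k}" "q < l" "r < n" "x = pt n (pt l b q) r"
      using point_cases[OF x] by blast
    show ?thesis unfolding bqr(4) by (rule trans[OF all rotate]) (use bqr n in simp_all)
  qed
  then have "reach x y" if "x \<in> {1..n * (l * k)}" "y \<in> {1..n * (l * k)}" for x y
    using that sym trans by blast
  then show ?thesis unfolding transitive_hom_def reach_def by blast
qed

end

section \<open>The two families as instances of the locale\<close>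

lemma braid_action_psi:
  assumes "1 \<le> m" "4 \<le> k"
  shows "braid_action k m 1 (\<lambda>_ _. 0) (psi m)"
proof
  \<comment> \<open>For \<open>n = 1\<close> the only offset is 0 and a point coincides with its
    block index, so all translations vanish and \<open>compat\<close> is trivial modulo 1.\<close>
  have pt1: "pt 1 x 0 = x" if "0 < x" for x using that by (simp add: pt_def)
  show "psi m i permutes {1..1 * (m * k)}" if "i \<in> {1..k - 1}" for i
  proof (rule permutes_subset[OF psi_permutes])
    have "m * (i + 1) \<le> m * k" using that by (intro mult_le_mono2) auto
    then show "{m * (i - 1) + 1..m * (i + 1)} \<subseteq> {1..1 * (m * k)}" by auto
  qed (use that in auto)
  show "psi m i (pt 1 (pt m i q) r) = pt 1 (pt m (Suc i) q) ((r + 0) mod 1)"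
    if "i \<in> {1..k - 1}" "q < m" "r < 1" for i q r
    using that pt1 by (simp add: psi_pt_left)
  show "psi m i (pt 1 (pt m (Suc i) q) r) = pt 1 (pt m i (Suc q mod m)) ((r + 0) mod 1)"
    if "i \<in> {1..k - 1}" "q < m" "r < 1" for i q r
    using that pt1 by (simp add: psi_pt_right)
  show "psi m i (pt 1 (pt m b q) r) = pt 1 (pt m b q) (Suc r mod 1)"
    if "i \<in> {1..k - 1}" "b \<in> {1..k}" "b \<noteq> i" "b \<noteq> Suc i" "q < m" "r < 1" for i b q r
    using that pt1 by (simp add: psi_pt_other)
qed (use assms in auto)

lemma braid_action_phi:
  assumes k: "4 \<le> k" and l: "l dvd m" "0 < l" "0 < m"
    and t: "\<And>i j. \<lbrakk>i \<in> {1..k - 2}; j < l\<rbrakk> \<Longrightarrow>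
      [t i ((i - 1) * l + 1 + (1 + j) mod l) + t i (i * l + 1 + (1 + j) mod l)
       = t (i + 1) ((i + 1) * l + 1 + j) + t (i + 1) (i * l + 1 + (1 + j) mod l)] (mod (m div l))"
  shows "braid_action k l (m div l) t (phi k m l t)"
proof
  show "0 < m div l" using l by (auto elim!: dvdE)
  show "phi k m l t i permutes {1..m div l * (l * k)}" if "i \<in> {1..k - 1}" for i
    using phi_permutes[OF that l(2,1), of t] l by (simp flip: mult.assoc)
  have in_range: "pt l b q \<in> {1..k * l}" if "b \<in> {1..k}" "q < l" for b q
    using pt_in_iff[of b q l 0 k] that by (simp add: mult.commute)
  \<comment> \<open>The \<open>2 * l\<close> consecutive indices permuted by the middle factor of
    \<open>phi\<close> are exactly the two blocks \<open>i\<close> and \<open>i + 1\<close> of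
    length \<open>l\<close>.\<close>
  have in_block: "pt l b q \<in> {(i - 1) * l + 1..(i + 1) * l} \<longleftrightarrow> b = i \<or> b = Suc i"
    if "0 < i" "b \<in> {1..k}" "q < l" for i b q
    using pt_in_iff[of b q l "i - 1" "i + 1"] that by (auto simp: mult.commute)
  have step: "phi k m l t i (pt (m div l) (pt l b q) r) =
    (if b = i \<or> b = Suc i
     then pt (m div l) (psi l i (pt l b q)) ((r + t i (psi l i (pt l b q))) mod (m div l))
     else pt (m div l) (pt l b q) ((r + 1) mod (m div l)))"
    if "i \<in> {1..k - 1}" "b \<in> {1..k}" "q < l" "r < m div l" for i b q r
    using phi_pt[OF that(1) l(2) HOL.refl in_range[OF that(2,3)] that(4), of t] in_block[of i b q] that
    by simp
  show "phi k m l t i (pt (m div l) (pt l i q) r) =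
      pt (m div l) (pt l (Suc i) q) ((r + t i (pt l (Suc i) q)) mod (m div l))"
    if "i \<in> {1..k - 1}" "q < l" "r < m div l" for i q r
    using step[of i i q r] that k by (auto simp: psi_pt_left)
  show "phi k m l t i (pt (m div l) (pt l (Suc i) q) r) =
      pt (m div l) (pt l i (Suc q mod l)) ((r + t i (pt l i (Suc q mod l))) mod (m div l))"
    if "i \<in> {1..k - 1}" "q < l" "r < m div l" for i q r
    using step[of i "Suc i" q r] that k by (auto simp: psi_pt_right)
  show "phi k m l t i (pt (m div l) (pt l b q) r) = pt (m div l) (pt l b q) (Suc r mod (m div l))"
    if "i \<in> {1..k - 1}" "b \<in> {1..k}" "b \<noteq> i" "b \<noteq> Suc i" "q < l" "r < m div l" for i b q r
    using step[of i b q r] that by simp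
  \<comment> \<open>Unfolding \<open>pt\<close> turns the indices into those of the congruence
    assumed for \<open>t\<close>, with \<open>j = q\<close>.\<close>
  show "[t i (pt l i (Suc q mod l)) + t i (pt l (Suc i) (Suc q mod l))
       = t (Suc i) (pt l (Suc (Suc i)) q) + t (Suc i) (pt l (Suc i) (Suc q mod l))] (mod m div l)"
    if "i \<in> {1..k - 2}" "q < l" for i q
    using t[OF that] by (simp add: pt_def mult.commute)
qed (use k l in auto)

theorem proposition3p14:
  fixes m k :: nat
  assumes "1 \<le> m" and "6 < k"
  shows "((\<exists>!h. h \<in> homs_extending k (m * k) (psi m))
        \<and> (\<forall>h\<in>homs_extending k (m * k) (psi m).
             \<not> cyclic_hom k (m * k) h \<and> transitive_hom k (m * k) h))
       \<and> (\<forall>(l::nat) (t :: nat \<Rightarrow> nat \<Rightarrow> nat).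
            l dvd m \<longrightarrow> 1 \<le> l \<longrightarrow> l < m \<longrightarrow>
            (\<forall>i\<in>{1..k - 1}. \<forall>q\<in>{(i - 1) * l + 1..(i + 1) * l}. t i q < m div l) \<longrightarrow>
            (\<forall>i\<in>{1..k - 2}. \<forall>j<l.
               [t i ((i - 1) * l + 1 + (1 + j) mod l) + t i (i * l + 1 + (1 + j) mod l)
                = t (i + 1) ((i + 1) * l + 1 + j) + t (i + 1) (i * l + 1 + (1 + j) mod l)]
               (mod (m div l))) \<longrightarrow>
            (\<exists>!h. h \<in> homs_extending k (m * k) (phi k m l t))
          \<and> (\<forall>h\<in>homs_extending k (m * k) (phi k m l t).
               \<not> cyclic_hom k (m * k) h \<and> transitive_hom k (m * k) h))"
proof (intro conjI allI impI)
  interpret psi: braid_action k m 1 "\<lambda>_ _. 0" "psi m"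
    by (rule braid_action_psi) (use assms in auto)
  show "\<exists>!h. h \<in> homs_extending k (m * k) (psi m)"
    using psi.hom_ex1 by simp
  show "\<forall>h\<in>homs_extending k (m * k) (psi m).
      \<not> cyclic_hom k (m * k) h \<and> transitive_hom k (m * k) h"
    using psi.not_cyclic psi.transitive by simp
next
  fix l t
  assume l: "l dvd m" "1 \<le> l" "l < m"
    and t: "\<forall>i\<in>{1..k - 2}. \<forall>j<l.
               [t i ((i - 1) * l + 1 + (1 + j) mod l) + t i (i * l + 1 + (1 + j) mod l)
                = t (i + 1) ((i + 1) * l + 1 + j) + t (i + 1) (i * l + 1 + (1 + j) mod l)]
               (mod (m div l))"
  interpret phi: braid_action k l "m div l" t "phi k m l t"
    by (rule braid_action_phi) (use assms l t in auto)
  have N: "m div l * (l * k) = m * k" using l(1) by (simp flip: mult.assoc)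
  show "\<exists>!h. h \<in> homs_extending k (m * k) (phi k m l t)"
    using phi.hom_ex1 by (simp only: N)
  show "\<forall>h\<in>homs_extending k (m * k) (phi k m l t).
      \<not> cyclic_hom k (m * k) h \<and> transitive_hom k (m * k) h"
    using phi.not_cyclic phi.transitive by (simp only: N) blast
qed

end
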